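(* Fix $n,K,T\in\mathbb{Z}_{+}$ and any product distribution $\mathcal{D}=\mathcal{D}_1\times\cdots\times\mathcal{D}_n$ of bidders' values as in the context. Suppose each bidder $i\in[n]$ runs the Meta-Algorithm with an online learning algorithm $\mathcal{A}_i$ (over $K+1$ actions) whose regret is at most $\mathrm{Reg}_{\mathcal{A}_i}$ for every (possibly adaptively chosen) sequence of reward vectors in $[-1,1]^{K+1}$. Suppose that in every round $t\in[T]$ the auctioneer chooses an auction format $\mathcal{M}^{(t)}=(\mathbf{x}^{(t)},\mathbf{p}^{(t)})$ satisfying allocation monotonicity and voluntary participation (the choice may be randomized and may depend adaptively on everything observed so far, including the bidders' current strategies). Then the auctioneer's expected cumulative revenue satisfies \[ \mathbb{E}\Big[\sum_{t\in[T]}\sum_{i\in[n]}p_i^{(t)}(\mathbf{b}^{(t)})\Big]\le \mathrm{Mye}(\mathcal{D})\cdot T+\sum_{i\in[n]}\mathrm{Reg}_{\mathcal{A}_i}. \]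
   Context: Setting. There are $n$ bidders. Bidder $i$'s value $v_i\in[0,1]$ is drawn independently from a continuous distribution $\mathcal{D}_i$ on $[0,1]$ with CDF $F_i$; $F_i^{-1}(y):=\inf\{v\in[0,1]:F_i(v)\ge y\}$ is its quantile function and $\mathcal{D}:=\mathcal{D}_1\times\cdots\times\mathcal{D}_n$. The bid set is $B:=\{j/K: j=0,\dots,K\}$. A bidding strategy is any function $s:[0,1]\to B$; it is monotone if $v\le v'$ implies $s(v)\le s(v')$. For a vector $\mathbf{b}$ we write $(b_i,\mathbf{b}_{-i})$ to separate coordinate $i$ from the others. An allocation vector lies in $\Delta([n])$, the set of vectors with nonnegative entries summing to at most $1$ (entry $i$ is the probability bidder $i$ gets the item). Repeated auction game over $T$ rounds: in round $t$ each bidder $i$ selects a bidding strategy $s_i^{(t)}$; then the auctioneer selects an auction format $\mathcal{M}^{(t)}=(\mathbf{x}^{(t)},\mathbf{p}^{(t)})$ with $\mathbf{x}^{(t)}:B^n\to\Delta([n])$ and $\mathbf{p}^{(t)}:B^n\to[0,1]^n$; then $\mathbf{v}^{(t)}\sim\mathcal{D}$ is drawn fresh and independently, bids are $b_i^{(t)}=s_i^{(t)}(v_i^{(t)})$, and $\mathbf{b}^{(t)}$ and $\mathcal{M}^{(t)}$ are revealed; bidder $i$ receives the item w.p. $x_i^{(t)}(\mathbf{b}^{(t)})$ and pays $p_i^{(t)}(\mathbf{b}^{(t)})$. Formats must satisfy: (allocation monotonicity) for all $i$, $\mathbf{b}_{-i}\in B^{n-1}$, $b_i\le b_i'$ in $B$: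 $x_i^{(t)}(b_i,\mathbf{b}_{-i})\le x_i^{(t)}(b_i',\mathbf{b}_{-i})$; (voluntary participation) $p_i^{(t)}(0,\mathbf{b}_{-i})=0$ for all $i,\mathbf{b}_{-i}$. Utility of bidder $i$ in round $t$ for a strategy $s$: $u_i^{(t)}(s):=\mathbb{E}_{v_i\sim\mathcal{D}_i}[x_i^{(t)}(s(v_i),\mathbf{b}_{-i}^{(t)})v_i-p_i^{(t)}(s(v_i),\mathbf{b}_{-i}^{(t)})]$, where $\mathbf{b}_{-i}^{(t)}$ are the realized bids of the others. Quantile strategies. A quantile strategy is $\boldsymbol{\pi}\in\Delta([K+1])$ (the probability simplex in $\mathbb{R}^{K+1}$). Write $\Pi_0:=0$, $\Pi_j:=\sum_{\ell=1}^j\pi_\ell$. For bidder $i$, the monotone strategy $s_{i,\boldsymbol{\pi}}$ is: $s_{i,\boldsymbol{\pi}}(v)=0$ if $v\in[0,F_i^{-1}(\Pi_1)]$, and $s_{i,\boldsymbol{\pi}}(v)=\frac{j-1}{K}$ if $v\in(F_i^{-1}(\Pi_{j-1}),F_i^{-1}(\Pi_j)]$ for $j\in\{2,\dots,K+1\}$. The quantile utility is $q_i^{(t)}(\boldsymbol{\pi}):=u_i^{(t)}(s_{i,\boldsymbol{\pi}})$. Define the vector $\mathbf{g}_i^{(t)}(\boldsymbol{\pi})\in\mathbb{R}^{K+1}$ by, for $k\in[K+1]$, \[ g_{i,k}^{(t)}(\boldsymbol{\pi}):=\sum_{j=k}^{K}\Big(x_i^{(t)}\big(\tfrac{j-1}{K},\mathbf{b}_{-i}^{(t)}\big)-x_i^{(t)}\big(\tfrac{j}{K},\mathbf{b}_{-i}^{(t)}\big)\Big)F_i^{-1}(\Pi_j)+x_i^{(t)}(1,\mathbf{b}_{-i}^{(t)})-p_i^{(t)}\big(\tfrac{k-1}{K},\mathbf{b}_{-i}^{(t)}\big)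 \] (this is the gradient of $q_i^{(t)}$). Online learning. An algorithm $\mathcal{A}$ over $K+1$ actions outputs in each round $t$ a distribution $\boldsymbol{\pi}^{(t)}\in\Delta([K+1])$, then observes a reward vector $\mathbf{r}^{(t)}\in[-1,1]^{K+1}$. Its regret is $\max_{j\in[K+1]}\sum_{t\in[T]}(r_j^{(t)}-\sum_k\pi_k^{(t)}r_k^{(t)})$; saying it has regret at most $\mathrm{Reg}_{\mathcal{A}}$ means this bound holds for every reward sequence. Meta-Algorithm (for bidder $i$, input $\mathcal{A}$ and $F_i$): in each round $t$, $\mathcal{A}$ outputs $\boldsymbol{\pi}^{(i,t)}\in\Delta([K+1])$; bidder $i$ plays $s_i^{(t)}:=s_{i,\boldsymbol{\pi}^{(i,t)}}$; after the round, the reward vector $\mathbf{r}^{(t)}:=\mathbf{g}_i^{(t)}(\boldsymbol{\pi}^{(i,t)})$ is fed to $\mathcal{A}$. Myerson benchmark. A (continuous) auction $\mathcal{M}=(\mathbf{x},\mathbf{p})$ has $\mathbf{x}:[0,1]^n\to\Delta([n])$, $\mathbf{p}:[0,1]^n\to[0,1]^n$. It is IR if $x_i(v_i,\mathbf{b}_{-i})v_i-p_i(v_i,\mathbf{b}_{-i})\ge0$ for all $i,v_i,\mathbf{b}_{-i}$, and IC if $x_i(v_i,\mathbf{b}_{-i})v_i-p_i(v_i,\mathbf{b}_{-i})\ge x_i(b_i,\mathbf{b}_{-i})v_i-p_i(b_i,\mathbf{b}_{-i})$ for all $i,v_i,b_i,\mathbf{b}_{-i}$. Its revenue is $\mathrm{Rev}_{\mathcal{M}}(\mathcal{D}):=\mathbb{E}_{\mathbf{v}\sim\mathcal{D}}[\sum_i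 p_i(\mathbf{v})]$, and $\mathrm{Mye}(\mathcal{D})$ is the supremum of $\mathrm{Rev}_{\mathcal{M}}(\mathcal{D})$ over IC and IR auctions. *)

theory Defs
  imports "HOL-Probability.Probability"
begin

text \<open>Bid / value vectors are functions nat => real; only coordinates i < n matter
  (vectors in B^n or [0,1]^n are taken extensional via PiE).\<close>
type_synonym bids = "nat \<Rightarrow> real"
type_synonym rule = "bids \<Rightarrow> nat \<Rightarrow> real"
text \<open>An auction format is a pair (x, p): allocation rule and payment rule.\<close>
type_synonym fmt = "rule \<times> rule"

definition bidset :: "nat \<Rightarrow> real set" where
  "bidset K = (\<lambda>j. real j / real K) ` {0..K}"

definition valid_format :: "nat \<Rightarrow> nat \<Rightarrow> fmt \<Rightarrow> bool" where
  "valid_format n K M \<longleftrightarrow>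
     (\<forall>b\<in>PiE {..<n} (\<lambda>_. bidset K).
        (\<forall>i<n. 0 \<le> fst M b i) \<and> (\<Sum>i<n. fst M b i) \<le> 1 \<and>
        (\<forall>i<n. 0 \<le> snd M b i \<and> snd M b i \<le> 1)) \<and>
     (\<forall>i<n. \<forall>b\<in>PiE {..<n} (\<lambda>_. bidset K). \<forall>\<beta>\<in>bidset K. \<forall>\<beta>'\<in>bidset K.
        \<beta> \<le> \<beta>' \<longrightarrow> fst M (b(i := \<beta>)) i \<le> fst M (b(i := \<beta>')) i) \<and>
     (\<forall>i<n. \<forall>b\<in>PiE {..<n} (\<lambda>_. bidset K). snd M (b(i := 0)) i = 0)"

definition value_dist :: "real measure \<Rightarrow> bool" where
  "value_dist Dm \<longleftrightarrow> prob_space Dm \<and> sets Dm = sets borel \<and>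
     measure Dm {0..1} = 1 \<and> (\<forall>v. measure Dm {v} = 0)"

definition quantile :: "real measure \<Rightarrow> real \<Rightarrow> real" where
  "quantile Dm y = Inf {v \<in> {0..1}. cdf Dm v \<ge> y}"

definition prob_simplex :: "nat \<Rightarrow> (nat \<Rightarrow> real) \<Rightarrow> bool" where
  "prob_simplex K \<pi> \<longleftrightarrow> (\<forall>k\<in>{1..K+1}. 0 \<le> \<pi> k) \<and> (\<Sum>k=1..K+1. \<pi> k) = 1"

definition cumsum :: "(nat \<Rightarrow> real) \<Rightarrow> nat \<Rightarrow> real" where
  "cumsum \<pi> j = (\<Sum>l=1..j. \<pi> l)"

text \<open>The monotone strategy s_{i,pi}. (Values above F^{-1}(Pi_{K+1}), a null set, bid 0.)\<close>
definition qstrat :: "real measure \<Rightarrow> nat \<Rightarrow> (nat \<Rightarrow> real) \<Rightarrow> real \<Rightarrow> real" where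
  "qstrat Dm K \<pi> v =
     (if v \<le> quantile Dm (cumsum \<pi> 1) then 0
      else if (\<exists>j\<in>{2..K+1}. quantile Dm (cumsum \<pi> (j-1)) < v \<and> v \<le> quantile Dm (cumsum \<pi> j))
      then real ((THE j. j \<in> {2..K+1} \<and> quantile Dm (cumsum \<pi> (j-1)) < v \<and>
                          v \<le> quantile Dm (cumsum \<pi> j)) - 1) / real K
      else 0)"

text \<open>The gradient vector g_i^{(t)}(pi) for format M and realized bid vector b (only b_{-i} is used).
  Entries outside 1..K+1 are set to 0.\<close>
definition gvec :: "nat \<Rightarrow> real measure \<Rightarrow> nat \<Rightarrow> fmt \<Rightarrow> bids \<Rightarrow> (nat \<Rightarrow> real) \<Rightarrow> nat \<Rightarrow> real" where
  "gvec i Dm K M b \<pi> k =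
     (if k \<in> {1..K+1} then
        (\<Sum>j=k..K. (fst M (b(i := real (j-1) / real K)) i - fst M (b(i := real j / real K)) i)
                    * quantile Dm (cumsum \<pi> j))
        + fst M (b(i := 1)) i - snd M (b(i := real (k-1) / real K)) i
      else 0)"

text \<open>A (deterministic) online learning algorithm over K+1 actions maps the list of past reward
  vectors to the current distribution pi in Delta([K+1]).\<close>
type_synonym learner = "(nat \<Rightarrow> real) list \<Rightarrow> nat \<Rightarrow> real"

definition regret :: "nat \<Rightarrow> nat \<Rightarrow> (nat \<Rightarrow> nat \<Rightarrow> real) \<Rightarrow> (nat \<Rightarrow> nat \<Rightarrow> real) \<Rightarrow> real" where
  "regret K T \<pi> r = Max ((\<lambda>j. \<Sum>t<T. (r t j - (\<Sum>k=1..K+1. \<pi> t k * r t k))) ` {1..K+1})"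

definition regret_bounded :: "nat \<Rightarrow> nat \<Rightarrow> learner \<Rightarrow> real \<Rightarrow> bool" where
  "regret_bounded K T A R \<longleftrightarrow>
     (\<forall>rs. (\<forall>r\<in>set rs. \<forall>k\<in>{1..K+1}. \<bar>r k\<bar> \<le> 1) \<longrightarrow> prob_simplex K (A rs)) \<and>
     (\<forall>r::nat \<Rightarrow> nat \<Rightarrow> real. (\<forall>t<T. \<forall>k\<in>{1..K+1}. \<bar>r t k\<bar> \<le> 1) \<longrightarrow>
        regret K T (\<lambda>t. A (map r [0..<t])) r \<le> R)"

definition rewards_of :: "learner \<Rightarrow> nat \<Rightarrow> real measure \<Rightarrow> nat \<Rightarrow> (fmt \<times> bids) list
     \<Rightarrow> (nat \<Rightarrow> real) list" where
  "rewards_of Ai i Dm K h =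
     foldl (\<lambda>rs Mb. rs @ [gvec i Dm K (fst Mb) (snd Mb) (Ai rs)]) [] h"

text \<open>An (adaptive, deterministic given its seed) auctioneer maps the round, the history of
  formats and bids, and the bidders' current quantile strategies to a format.\<close>
type_synonym auctioneer = "nat \<Rightarrow> (fmt \<times> bids) list \<Rightarrow> (nat \<Rightarrow> nat \<Rightarrow> real) \<Rightarrow> fmt"

fun run :: "nat \<Rightarrow> nat \<Rightarrow> (nat \<Rightarrow> real measure) \<Rightarrow> (nat \<Rightarrow> learner) \<Rightarrow> auctioneer
            \<Rightarrow> (nat \<times> nat \<Rightarrow> real) \<Rightarrow> nat \<Rightarrow> (fmt \<times> bids) list" where
  "run n K D A Auc V 0 = []"
| "run n K D A Auc V (Suc t) =
     (let h = run n K D A Auc V t;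
          \<pi> = (\<lambda>i. A i (rewards_of (A i) i (D i) K h));
          M = Auc t h \<pi>;
          b = (\<lambda>i. if i < n then qstrat (D i) K (\<pi> i) (V (t, i)) else undefined)
      in h @ [(M, b)])"

definition revenue :: "nat \<Rightarrow> nat \<Rightarrow> nat \<Rightarrow> (nat \<Rightarrow> real measure) \<Rightarrow> (nat \<Rightarrow> learner)
     \<Rightarrow> auctioneer \<Rightarrow> (nat \<times> nat \<Rightarrow> real) \<Rightarrow> real" where
  "revenue n K T D A Auc V =
     (let h = run n K D A Auc V T in
        \<Sum>t<T. \<Sum>i<n. snd (fst (h ! t)) (snd (h ! t)) i)"

definition values_measure :: "nat \<Rightarrow> nat \<Rightarrow> (nat \<Rightarrow> real measure) \<Rightarrow> (nat \<times> nat \<Rightarrow> real) measure" where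
  "values_measure n T D = PiM ({..<T} \<times> {..<n}) (\<lambda>ti. D (snd ti))"

definition cont_auction :: "nat \<Rightarrow> rule \<Rightarrow> rule \<Rightarrow> bool" where
  "cont_auction n x p \<longleftrightarrow>
     (\<forall>v\<in>PiE {..<n} (\<lambda>_. {0..1::real}).
        (\<forall>i<n. 0 \<le> x v i) \<and> (\<Sum>i<n. x v i) \<le> 1 \<and> (\<forall>i<n. 0 \<le> p v i \<and> p v i \<le> 1))"

definition IR :: "nat \<Rightarrow> rule \<Rightarrow> rule \<Rightarrow> bool" where
  "IR n x p \<longleftrightarrow> (\<forall>i<n. \<forall>v\<in>PiE {..<n} (\<lambda>_. {0..1::real}). x v i * v i - p v i \<ge> 0)"

definition IC :: "nat \<Rightarrow> rule \<Rightarrow> rule \<Rightarrow> bool" where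
  "IC n x p \<longleftrightarrow> (\<forall>i<n. \<forall>v\<in>PiE {..<n} (\<lambda>_. {0..1::real}). \<forall>b\<in>{0..1::real}.
      x v i * v i - p v i \<ge> x (v(i := b)) i * v i - p (v(i := b)) i)"

definition Rev :: "nat \<Rightarrow> (nat \<Rightarrow> real measure) \<Rightarrow> rule \<Rightarrow> real" where
  "Rev n D p = (\<integral>v. (\<Sum>i<n. p v i) \<partial>(PiM {..<n} D))"

definition Mye :: "nat \<Rightarrow> (nat \<Rightarrow> real measure) \<Rightarrow> real" where
  "Mye n D = Sup {Rev n D p | x p. cont_auction n x p \<and> IC n x p \<and> IR n x p}"

end

theory Submission
  imports Defs
begin

text \<open>
  Let \<open>\<theta>\<^sub>j\<close> be the quantile of \<open>\<Pi>\<^sub>j\<close>, and fix a round and the bids of the others. Telescoping over the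
  bid levels, bidder \<open>i\<close> pays the sum of \<open>p\<^sub>j - p\<^sub>j\<^sub>-\<^sub>1\<close> over those \<open>j\<close> with \<open>\<theta>\<^sub>j < v\<^sub>i\<close>, an event of
  probability \<open>1 - \<Pi>\<^sub>j\<close>. Summation by parts shows that the regret against the action that always bids 0 is
  the sum of \<open>(1 - \<Pi>\<^sub>j) ((p\<^sub>j - p\<^sub>j\<^sub>-\<^sub>1) - (x\<^sub>j - x\<^sub>j\<^sub>-\<^sub>1) \<theta>\<^sub>j)\<close>. Hence the expected payment equals this
  regret plus the expected value of the sum of \<open>(x\<^sub>j - x\<^sub>j\<^sub>-\<^sub>1) \<theta>\<^sub>j\<close> over \<open>\<theta>\<^sub>j < v\<^sub>i\<close>, which is the
  threshold payment of the IC and IR auction that runs the round's allocation rule on the quantile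
  bids. The second part is bounded by Myerson's revenue in each round, and the first by the regret
  of the learner over all rounds.
\<close>

text \<open>A non-integrable function has Bochner integral 0, so a nonnegative almost sure bound
  survives without any measurability of \<open>f\<close>. This covers payment rules and randomized
  auctioneers, about whose measurability nothing is known.\<close>

lemma (in prob_space) integral_le_nonneg_const:
  fixes f :: "'a \<Rightarrow> real"
  assumes "0 \<le> c" and "AE x in M. f x \<le> c"
  shows "(\<integral>x. f x \<partial>M) \<le> c"
proof (cases "integrable M f")
  case True
  then show ?thesis using assms(2) by (rule integral_le_const)
next
  case False
  then show ?thesis using assms(1) by (simp add: not_integrable_integral_eq)
qed

section \<open>Quantiles and quantile strategies\<close>

lemma value_dist_real_distribution:
  assumes "value_dist Dm"
  shows "real_distribution Dm"
proof -
  interpret prob_space Dm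
    using assms by (simp add: value_dist_def)
  show ?thesis
    by standard (use assms in \<open>auto simp: value_dist_def\<close>)
qed

lemma value_dist_AE_unit:
  assumes "value_dist Dm"
  shows "AE v in Dm. v \<in> {0..1}"
proof -
  interpret real_distribution Dm
    using assms by (rule value_dist_real_distribution)
  show ?thesis
    by (rule AE_in_set_eq_1[THEN iffD2]) (use assms in \<open>auto simp: value_dist_def\<close>)
qed

lemma cdf_value_dist:
  assumes "value_dist Dm"
  shows "cdf Dm 0 = 0" and "cdf Dm 1 = 1" and "isCont (cdf Dm) v"
proof -
  interpret real_distribution Dm
    using assms by (rule value_dist_real_distribution)
  have null: "AE v in Dm. v \<noteq> 0"
  proof (rule AE_I')
    show "{0} \<in> null_sets Dm"
      using assms by (auto simp: null_sets_def emeasure_eq_measure value_dist_def)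
  qed auto
  have "prob {..0} = prob {}"
    by (rule measure_eq_AE, use null value_dist_AE_unit[OF assms] in eventually_elim) auto
  then show "cdf Dm 0 = 0" by (simp add: cdf_def)
  have "prob {..1} = prob UNIV"
    by (rule measure_eq_AE, use value_dist_AE_unit[OF assms] in eventually_elim) auto
  then show "cdf Dm 1 = 1" using prob_space by (simp add: cdf_def)
  show "isCont (cdf Dm) v"
    using assms by (simp add: isCont_cdf value_dist_def)
qed

lemma quantile_in_unit:
  assumes "value_dist Dm" and "y \<le> 1"
  shows "quantile Dm y \<in> {0..1}"
proof -
  have 1: "1 \<in> {v \<in> {0..1}. y \<le> cdf Dm v}"
    using assms cdf_value_dist(2) by auto
  have "quantile Dm y \<le> 1"
    unfolding quantile_def by (rule cInf_lower[OF 1]) (auto intro!: bdd_belowI[of _ 0])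
  moreover have "0 \<le> quantile Dm y"
    unfolding quantile_def by (rule cInf_greatest) (use 1 in auto)
  ultimately show ?thesis by simp
qed

lemma quantile_mono:
  assumes "value_dist Dm" and "y \<le> y'" and "y' \<le> 1"
  shows "quantile Dm y \<le> quantile Dm y'"
  unfolding quantile_def
proof (rule cInf_superset_mono)
  show "{v \<in> {0..1}. y' \<le> cdf Dm v} \<noteq> {}"
    using assms cdf_value_dist(2)[OF assms(1)] by (auto intro!: exI[of _ 1])
  show "bdd_below {v \<in> {0..1}. y \<le> cdf Dm v}"
    by (auto intro!: bdd_belowI[of _ 0])
qed (use assms in auto)

text \<open>Continuity of the CDF makes the superlevel set closed, so its infimum is attained and
  the CDF there is at least \<open>y\<close>. The intermediate value theorem gives a point not above
  the quantile with CDF exactly \<open>y\<close>, and minimality forces the two to coincide.\<close>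

lemma cdf_quantile:
  assumes D: "value_dist Dm" and y: "0 \<le> y" "y \<le> 1"
  shows "cdf Dm (quantile Dm y) = y"
proof -
  interpret real_distribution Dm
    using D by (rule value_dist_real_distribution)
  let ?S = "{v \<in> {0..1}. y \<le> cdf Dm v}"
  let ?q = "quantile Dm y"
  have cont: "continuous_on X (cdf Dm)" for X
    by (intro continuous_at_imp_continuous_on ballI cdf_value_dist(3)[OF D])
  have "closed ({0..1} \<inter> cdf Dm -` {y..})"
    by (rule continuous_closed_preimage[OF cont]) auto
  moreover have "{0..1} \<inter> cdf Dm -` {y..} = ?S" by auto
  ultimately have "closed ?S" by simp
  then have "Inf ?S \<in> ?S"
    using y cdf_value_dist(2)[OF D]
    by (intro closed_contains_Inf) (auto intro!: bdd_belowI[of _ 0] exI[of _ 1])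
  then have q: "?q \<in> ?S" by (simp add: quantile_def)
  have "\<exists>x\<ge>0. x \<le> ?q \<and> cdf Dm x = y"
    by (rule IVT') (use q y cont cdf_value_dist(1)[OF D] in auto)
  then obtain x where x: "0 \<le> x" "x \<le> ?q" "cdf Dm x = y" by blast
  have "?q \<le> x"
    unfolding quantile_def
    by (rule cInf_lower) (use x q in \<open>auto intro!: bdd_belowI[of _ 0]\<close>)
  with x show ?thesis by simp
qed

section \<open>Cumulative masses and thresholds of a quantile strategy\<close>

lemma cumsum_simplex:
  assumes "prob_simplex K \<pi>"
  shows "\<And>j. j \<le> K + 1 \<Longrightarrow> 0 \<le> cumsum \<pi> j"
    and "cumsum \<pi> (K + 1) = 1"
    and "\<And>j k. j \<le> k \<Longrightarrow> k \<le> K + 1 \<Longrightarrow> cumsum \<pi> j \<le> cumsum \<pi> k"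
proof -
  show "0 \<le> cumsum \<pi> j" if "j \<le> K + 1" for j
    using assms that unfolding cumsum_def prob_simplex_def by (auto intro!: sum_nonneg)
  show "cumsum \<pi> (K + 1) = 1"
    using assms by (simp add: cumsum_def prob_simplex_def)
  show "cumsum \<pi> j \<le> cumsum \<pi> k" if "j \<le> k" "k \<le> K + 1" for j k
    unfolding cumsum_def
    by (rule sum_mono2) (use that assms in \<open>auto simp: prob_simplex_def\<close>)
qed

text \<open>Up to a null set, for \<open>j\<close> in \<open>{1..K}\<close> the strategy bids at
  least \<open>j / K\<close> exactly when the value exceeds this number: action \<open>j\<close>
  bids \<open>(j - 1) / K\<close> on the cell ending here.\<close>

definition threshold :: "real measure \<Rightarrow> (nat \<Rightarrow> real) \<Rightarrow> nat \<Rightarrow> real" where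
  "threshold Dm \<pi> j = quantile Dm (cumsum \<pi> j)"

lemma threshold_mono:
  assumes "value_dist Dm" and "prob_simplex K \<pi>" and "j \<le> k" and "k \<le> K + 1"
  shows "threshold Dm \<pi> j \<le> threshold Dm \<pi> k"
  using assms cumsum_simplex(2)[OF assms(2)] cumsum_simplex(3)[OF assms(2) _ order.refl, of k]
  unfolding threshold_def by (intro quantile_mono cumsum_simplex(3)[OF assms(2)]) auto

lemma threshold_in_unit:
  assumes "value_dist Dm" and "prob_simplex K \<pi>" and "j \<le> K + 1"
  shows "threshold Dm \<pi> j \<in> {0..1}"
  unfolding threshold_def using assms cumsum_simplex(2,3)[OF assms(2)]
  by (intro quantile_in_unit) (metis le_refl)+

lemma cdf_threshold:
  assumes "value_dist Dm" and "prob_simplex K \<pi>" and "j \<le> K + 1"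
  shows "cdf Dm (threshold Dm \<pi> j) = cumsum \<pi> j"
  unfolding threshold_def
  using assms cumsum_simplex(1)[OF assms(2), of j] cumsum_simplex(2)[OF assms(2)]
    cumsum_simplex(3)[OF assms(2) assms(3) order.refl]
  by (intro cdf_quantile) auto

text \<open>The index of the bid at value \<open>v\<close>: since thresholds increase, counting
  those below \<open>v\<close> finds the cell of \<open>v\<close> without a description operator,
  and it gives a sum of indicators.\<close>

definition level :: "nat \<Rightarrow> (nat \<Rightarrow> real) \<Rightarrow> real \<Rightarrow> nat" where
  "level K \<theta> v = card {j \<in> {1..K}. \<theta> j < v}"

lemma level_le: "level K \<theta> v \<le> K"
proof -
  have "card {j \<in> {1..K}. \<theta> j < v} \<le> card {1..K}"
    by (rule card_mono) auto
  then show ?thesis by (simp add: level_def)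
qed

text \<open>The thresholds below \<open>v\<close> form an initial segment of \<open>{1..K}\<close>.
  At \<open>m = 0\<close> and at \<open>m = K\<close> only one of the two bracketing inequalities
  remains.\<close>

lemma level_eqI:
  assumes mono: "\<And>j k. 1 \<le> j \<Longrightarrow> j \<le> k \<Longrightarrow> k \<le> K \<Longrightarrow> \<theta> j \<le> \<theta> k"
    and "m \<le> K" and "m = 0 \<or> \<theta> m < v" and "m < K \<Longrightarrow> v \<le> \<theta> (Suc m)"
  shows "level K \<theta> v = m"
proof -
  have "{j \<in> {1..K}. \<theta> j < v} = {1..m}"
  proof (intro set_eqI iffI)
    fix j assume j: "j \<in> {j \<in> {1..K}. \<theta> j < v}"
    show "j \<in> {1..m}"
    proof (rule ccontr)
      assume "j \<notin> {1..m}"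
      with j have "Suc m \<le> j" "m < K" by auto
      with mono[of "Suc m" j] assms(4) j show False by auto
    qed
  next
    fix j assume j: "j \<in> {1..m}"
    then have "\<theta> j \<le> \<theta> m" "\<theta> m < v"
      using mono[of j m] assms(2,3) by auto
    with j assms(2) show "j \<in> {j \<in> {1..K}. \<theta> j < v}" by auto
  qed
  then show ?thesis by (simp add: level_def)
qed

text \<open>Makes any function of a bidder's own bid linear in the indicators of the events
  \<open>\<theta> j < v\<close>. In the induction, either the top threshold lies below
  \<open>v\<close>, and then so do all others, or its summand vanishes.\<close>

lemma level_telescope:
  fixes f :: "nat \<Rightarrow> real"
  assumes "\<And>j k. 1 \<le> j \<Longrightarrow> j \<le> k \<Longrightarrow> k \<le> K \<Longrightarrow> \<theta> j \<le> \<theta> k"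
  shows "f (level K \<theta> v) = f 0 + (\<Sum>j=1..K. of_bool (\<theta> j < v) * (f j - f (j - 1)))"
  using assms
proof (induction K)
  case 0
  then show ?case by (simp add: level_def)
next
  case (Suc K)
  have IH: "f (level K \<theta> v) = f 0 + (\<Sum>j=1..K. of_bool (\<theta> j < v) * (f j - f (j - 1)))"
    using Suc by simp
  show ?case
  proof (cases "\<theta> (Suc K) < v")
    case True
    then have *: "\<theta> j < v" if "j \<in> {1..Suc K}" for j
      using Suc.prems[of j "Suc K"] that by auto
    then have "{j \<in> {1..K}. \<theta> j < v} = {1..K}" "{j \<in> {1..Suc K}. \<theta> j < v} = {1..Suc K}"
      by auto
    then have "level K \<theta> v = K" "level (Suc K) \<theta> v = Suc K" by (simp_all add: level_def)
    with IH True show ?thesis by simp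
  next
    case False
    then have "{j \<in> {1..Suc K}. \<theta> j < v} = {j \<in> {1..K}. \<theta> j < v}"
      by (auto simp: le_Suc_eq)
    then have "level (Suc K) \<theta> v = level K \<theta> v" by (simp add: level_def)
    with IH False show ?thesis by simp
  qed
qed

lemma measurable_level [measurable]: "(\<lambda>v. real (level K \<theta> v)) \<in> borel_measurable borel"
proof -
  have "real (level K \<theta> v) = (\<Sum>j=1..K. indicator {\<theta> j<..} v)" for v
  proof -
    have "real (level K \<theta> v) = (\<Sum>j\<in>{j \<in> {1..K}. \<theta> j < v}. 1)"
      by (simp add: level_def)
    also have "\<dots> = (\<Sum>j=1..K. if \<theta> j < v then 1 else 0)"
      by (rule sum.inter_filter) simp
    also have "\<dots> = (\<Sum>j=1..K. indicator {\<theta> j<..} v)"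
      by (rule sum.cong) (auto simp: indicator_def)
    finally show ?thesis .
  qed
  then show ?thesis by simp
qed

lemma qstrat_eq_level:
  assumes D: "value_dist Dm" and \<pi>: "prob_simplex K \<pi>"
  shows "qstrat Dm K \<pi> v =
    (if v \<le> threshold Dm \<pi> (K + 1) then real (level K (threshold Dm \<pi>) v) / real K else 0)"
proof -
  let ?\<theta> = "threshold Dm \<pi>"
  note mono = threshold_mono[OF D \<pi>]
  let ?P = "\<lambda>j. j \<in> {2..K+1} \<and> ?\<theta> (j - 1) < v \<and> v \<le> ?\<theta> j"
  have q: "qstrat Dm K \<pi> v = (if v \<le> ?\<theta> 1 then 0 else if \<exists>j. ?P j then real ((THE j. ?P j) - 1) / real K else 0)"
    unfolding qstrat_def threshold_def[symmetric] Bex_def ..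
  have lev: "level K ?\<theta> v = m" if "m \<le> K" "m = 0 \<or> ?\<theta> m < v" "v \<le> ?\<theta> (Suc m)" for m
    by (rule level_eqI) (use that mono in auto)
  consider (low) "v \<le> ?\<theta> 1" | (mid) "?\<theta> 1 < v" "v \<le> ?\<theta> (K + 1)" | (high) "?\<theta> (K + 1) < v"
    by linarith
  then show ?thesis
  proof cases
    case low
    then have "level K ?\<theta> v = 0" using lev[of 0] by simp
    then show ?thesis using low q by simp
  next
    case mid
    \<comment> \<open>The first cell whose right end reaches \<open>v\<close>; minimality supplies
      the strict inequality at its left end.\<close>
    define j where "j = (LEAST j. v \<le> ?\<theta> j \<and> 1 \<le> j)"
    have j: "v \<le> ?\<theta> j" "1 \<le> j"
      using LeastI[of "\<lambda>j. v \<le> ?\<theta> j \<and> 1 \<le> j" "K + 1"] mid by (auto simp: j_def)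
    have jK: "j \<le> K + 1"
      unfolding j_def by (rule Least_le) (use mid in auto)
    have "j \<noteq> 1" using j mid by auto
    then have j2: "2 \<le> j" using j by simp
    have "\<not> (v \<le> ?\<theta> (j - 1) \<and> 1 \<le> j - 1)"
      using not_less_Least[of "j - 1" "\<lambda>j. v \<le> ?\<theta> j \<and> 1 \<le> j"] j2 unfolding j_def by linarith
    then have jl: "?\<theta> (j - 1) < v" using j2 by auto
    have P: "?P j" using j jK j2 jl by auto
    have uniq: "k = j" if k: "?P k" for k
    proof (rule antisym; rule ccontr)
      assume "\<not> k \<le> j"
      then have "?\<theta> j \<le> ?\<theta> (k - 1)" using k by (intro mono) auto
      then show False using k j by auto
    next
      assume "\<not> j \<le> k"
      then have "?\<theta> k \<le> ?\<theta> (j - 1)" using jK by (intro mono) auto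
      then show False using k jl by auto
    qed
    have "(THE j. ?P j) = j" using P uniq by (rule the_equality)
    moreover have "level K ?\<theta> v = j - 1"
      using lev[of "j - 1"] j jK j2 jl by auto
    ultimately show ?thesis using q mid P by auto
  next
    case high
    have "\<not> ?P j" for j using mono[of j "K + 1"] high by auto
    moreover have "\<not> v \<le> ?\<theta> 1" using mono[of 1 "K + 1"] high by auto
    ultimately show ?thesis using q high by auto
  qed
qed

lemma measurable_qstrat:
  assumes "value_dist Dm" and "prob_simplex K \<pi>"
  shows "qstrat Dm K \<pi> \<in> borel_measurable borel"
  unfolding qstrat_eq_level[OF assms, abs_def] by measurable

lemma level_bid_in_bidset: "real (level K \<theta> v) / real K \<in> bidset K"
  using level_le[of K \<theta> v] by (auto simp: bidset_def)

lemma zero_in_bidset: "0 \<in> bidset K"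
  by (auto simp: bidset_def image_iff intro!: bexI[of _ 0])

lemma grid_in_bidset: "j \<le> K \<Longrightarrow> real j / real K \<in> bidset K"
  by (auto simp: bidset_def)

lemma finite_bidset: "finite (bidset K)"
  by (simp add: bidset_def)

lemma qstrat_in_bidset:
  assumes "value_dist Dm" and "prob_simplex K \<pi>"
  shows "qstrat Dm K \<pi> v \<in> bidset K"
  by (simp add: qstrat_eq_level[OF assms] level_bid_in_bidset zero_in_bidset)

text \<open>The exceptional values lie above the last threshold, where the CDF has already reached
  the total mass 1.\<close>

lemma AE_qstrat_eq_level:
  assumes "value_dist Dm" and "prob_simplex K \<pi>"
  shows "AE v in Dm. qstrat Dm K \<pi> v = real (level K (threshold Dm \<pi>) v) / real K"
proof -
  interpret real_distribution Dm
    using assms(1) by (rule value_dist_real_distribution)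
  have "prob {..threshold Dm \<pi> (K + 1)} = 1"
    using cdf_threshold[OF assms, of "K + 1"] cumsum_simplex(2)[OF assms(2)] by (simp add: cdf_def)
  then have "AE v in Dm. v \<in> {..threshold Dm \<pi> (K + 1)}"
    by (subst AE_in_set_eq_1) auto
  then show ?thesis
    by eventually_elim (simp add: qstrat_eq_level[OF assms])
qed

lemma integral_above_threshold:
  assumes "value_dist Dm" and "prob_simplex K \<pi>" and "j \<le> K + 1"
  shows "integrable Dm (\<lambda>v. of_bool (threshold Dm \<pi> j < v) :: real)"
    and "(\<integral>v. of_bool (threshold Dm \<pi> j < v) \<partial>Dm) = 1 - cumsum \<pi> j"
proof -
  interpret real_distribution Dm
    using assms(1) by (rule value_dist_real_distribution)
  have eq: "(\<lambda>v. of_bool (threshold Dm \<pi> j < v) :: real) = indicator {threshold Dm \<pi> j<..}"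
    by (auto simp: indicator_def fun_eq_iff)
  show "integrable Dm (\<lambda>v. of_bool (threshold Dm \<pi> j < v) :: real)"
    unfolding eq by (rule integrable_real_indicator) (auto simp: emeasure_eq_measure)
  have "prob {threshold Dm \<pi> j<..} = prob (space Dm - {..threshold Dm \<pi> j})"
    by (rule arg_cong[of _ _ prob]) auto
  also have "\<dots> = 1 - cumsum \<pi> j"
    using cdf_threshold[OF assms] by (subst prob_compl) (auto simp: cdf_def)
  finally show "(\<integral>v. of_bool (threshold Dm \<pi> j < v) \<partial>Dm) = 1 - cumsum \<pi> j"
    unfolding eq by simp
qed

section \<open>Algebra of the gradient vectors\<close>

text \<open>The utility that a bidder whose value is exactly the threshold loses by raising the bid
  from \<open>(j - 1) / K\<close> to \<open>j / K\<close>.\<close>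

definition pay_excess :: "nat \<Rightarrow> real measure \<Rightarrow> nat \<Rightarrow> fmt \<Rightarrow> bids \<Rightarrow> (nat \<Rightarrow> real) \<Rightarrow> nat \<Rightarrow> real" where
  "pay_excess i Dm K M b \<pi> j =
     (snd M (b(i := real j / real K)) i - snd M (b(i := real (j - 1) / real K)) i)
     - (fst M (b(i := real j / real K)) i - fst M (b(i := real (j - 1) / real K)) i) * threshold Dm \<pi> j"

text \<open>Only the bids of the others enter, so this quantity stays constant while the value of
  bidder \<open>i\<close> is integrated out.\<close>

lemma pay_excess_upd: "pay_excess i Dm K M (b(i := \<beta>)) \<pi> j = pay_excess i Dm K M b \<pi> j"
  by (simp add: pay_excess_def)

text \<open>The two tail sums differ in the single summand \<open>j = k\<close>, and the price terms
  in one step of the grid.\<close>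

lemma gvec_diff_Suc:
  assumes "k \<in> {1..K}"
  shows "gvec i Dm K M b \<pi> k - gvec i Dm K M b \<pi> (Suc k) = pay_excess i Dm K M b \<pi> k"
  using assms
  by (simp add: gvec_def pay_excess_def threshold_def sum.atLeast_Suc_atMost[of k K] algebra_simps)

text \<open>Action 1 always bids 0. Its advantage over action \<open>k\<close> is the sum of
  \<open>pay_excess\<close> over \<open>j < k\<close>; averaging over \<open>k\<close> and
  exchanging the sums weights each \<open>j\<close> by the mass of the actions beyond it.\<close>

lemma gvec_regret_first:
  assumes "prob_simplex K \<pi>"
  shows "gvec i Dm K M b \<pi> 1 - (\<Sum>k=1..K+1. \<pi> k * gvec i Dm K M b \<pi> k)
       = (\<Sum>j=1..K. (1 - cumsum \<pi> j) * pay_excess i Dm K M b \<pi> j)"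
proof -
  let ?g = "gvec i Dm K M b \<pi>" and ?d = "pay_excess i Dm K M b \<pi>"
  have sum1: "(\<Sum>k=1..K+1. \<pi> k) = 1"
    using assms by (simp add: prob_simplex_def)
  have diff: "?g 1 - ?g k = (\<Sum>j=1..<k. ?d j)" if "k \<in> {1..K+1}" for k
    using that
  proof (induction k)
    case (Suc k)
    show ?case
    proof (cases "k = 0")
      case False
      with Suc have "?g 1 - ?g k = (\<Sum>j=1..<k. ?d j)" "k \<in> {1..K}" by auto
      with gvec_diff_Suc[of k K i Dm M b \<pi>] False show ?thesis by simp
    qed simp
  qed simp
  have tail: "(\<Sum>k=1..K+1. of_bool (j < k) * \<pi> k) = 1 - cumsum \<pi> j" if "j \<in> {1..K}" for j
  proof -
    have "(\<Sum>k=1..K+1. \<pi> k) = (\<Sum>k\<in>{1..j} \<union> {j<..K+1}. \<pi> k)"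
      by (rule sum.cong) (use that in auto)
    also have "\<dots> = cumsum \<pi> j + (\<Sum>k\<in>{j<..K+1}. \<pi> k)"
      unfolding cumsum_def by (rule sum.union_disjoint) auto
    also have "(\<Sum>k\<in>{j<..K+1}. \<pi> k) = (\<Sum>k=1..K+1. of_bool (j < k) * \<pi> k)"
      by (rule sum.mono_neutral_cong_left) auto
    finally show ?thesis using sum1 by simp
  qed
  have "?g 1 - (\<Sum>k=1..K+1. \<pi> k * ?g k) = (\<Sum>k=1..K+1. \<pi> k * (?g 1 - ?g k))"
    using sum1 by (simp add: right_diff_distrib sum_subtractf flip: sum_distrib_right)
  also have "\<dots> = (\<Sum>k=1..K+1. \<Sum>j=1..K. of_bool (j < k) * \<pi> k * ?d j)"
  proof (rule sum.cong[OF refl])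
    fix k assume k: "k \<in> {1..K+1}"
    have "(\<Sum>j=1..<k. ?d j) = (\<Sum>j=1..K. of_bool (j < k) * ?d j)"
      by (rule sum.mono_neutral_cong_left) (use k in auto)
    then show "\<pi> k * (?g 1 - ?g k) = (\<Sum>j=1..K. of_bool (j < k) * \<pi> k * ?d j)"
      by (simp only: diff[OF k] sum_distrib_left ac_simps)
  qed
  also have "\<dots> = (\<Sum>j=1..K. (\<Sum>k=1..K+1. of_bool (j < k) * \<pi> k) * ?d j)"
    by (subst sum.swap) (simp only: sum_distrib_right)
  also have "\<dots> = (\<Sum>j=1..K. (1 - cumsum \<pi> j) * ?d j)"
    by (rule sum.cong[OF refl]) (simp only: tail)
  finally show ?thesis .
qed

section \<open>Bounds for valid formats and for the rewards\<close>

lemma upd_bid_in_PiE: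
  assumes "b \<in> PiE {..<n} (\<lambda>_. bidset K)" and "i < n" and "j \<le> K"
  shows "b(i := real j / real K) \<in> PiE {..<n} (\<lambda>_. bidset K)"
  using assms grid_in_bidset[of j K] by (auto simp: PiE_def extensional_def)

lemma valid_format_alloc:
  assumes "valid_format n K M" and "b \<in> PiE {..<n} (\<lambda>_. bidset K)" and "i < n"
  shows "fst M b i \<in> {0..1}"
proof -
  have *: "\<forall>i<n. 0 \<le> fst M b i" "(\<Sum>i<n. fst M b i) \<le> 1"
    using assms by (auto simp: valid_format_def)
  have "fst M b i \<le> (\<Sum>i<n. fst M b i)"
    by (rule member_le_sum) (use * assms in auto)
  with * assms show ?thesis by auto
qed

lemma valid_format_pay:
  assumes "valid_format n K M" and "b \<in> PiE {..<n} (\<lambda>_. bidset K)" and "i < n"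
  shows "snd M b i \<in> {0..1}"
  using assms by (auto simp: valid_format_def)

lemma valid_format_mono:
  assumes "valid_format n K M" and "b \<in> PiE {..<n} (\<lambda>_. bidset K)" and "i < n" and "j \<le> k" and "k \<le> K"
  shows "fst M (b(i := real j / real K)) i \<le> fst M (b(i := real k / real K)) i"
proof -
  have "real j / real K \<le> real k / real K"
    using assms by (intro divide_right_mono) auto
  with assms grid_in_bidset[of j K] grid_in_bidset[of k K] show ?thesis
    unfolding valid_format_def by (meson order.trans)
qed

lemma valid_format_pay_zero:
  assumes "valid_format n K M" and "b \<in> PiE {..<n} (\<lambda>_. bidset K)" and "i < n"
  shows "snd M (b(i := 0)) i = 0"
  using assms by (auto simp: valid_format_def)

text \<open>Makes the regret guarantee applicable. Allocation monotonicity and thresholds in the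
  unit interval place the tail sum between \<open>x (k - 1) - x K\<close> and 0, so the entry lies
  between \<open>x (k - 1) - p (k - 1)\<close> and \<open>x K - p (k - 1)\<close>.\<close>

lemma abs_gvec_le_1:
  assumes D: "value_dist Dm" and \<pi>: "prob_simplex K \<pi>" and "K > 0"
    and M: "valid_format n K M" and b: "b \<in> PiE {..<n} (\<lambda>_. bidset K)" and i: "i < n"
    and k: "k \<in> {1..K+1}"
  shows "\<bar>gvec i Dm K M b \<pi> k\<bar> \<le> 1"
proof -
  define x where "x j = fst M (b(i := real j / real K)) i" for j :: nat
  define p where "p j = snd M (b(i := real j / real K)) i" for j :: nat
  define S where "S = (\<Sum>j=k..K. (x (j - 1) - x j) * threshold Dm \<pi> j)"
  have x: "x j \<in> {0..1}" if "j \<le> K" for j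
    unfolding x_def by (rule valid_format_alloc[OF M upd_bid_in_PiE[OF b i that] i])
  have p: "p j \<in> {0..1}" if "j \<le> K" for j
    unfolding p_def by (rule valid_format_pay[OF M upd_bid_in_PiE[OF b i that] i])
  have mono: "x (j - 1) \<le> x j" if "j \<in> {k..K}" for j
    unfolding x_def by (rule valid_format_mono[OF M b i]) (use that in auto)
  have th: "threshold Dm \<pi> j \<in> {0..1}" if "j \<in> {k..K}" for j
    by (rule threshold_in_unit[OF D \<pi>]) (use that in auto)
  have g: "gvec i Dm K M b \<pi> k = S + x K - p (k - 1)"
    using k \<open>K > 0\<close> by (simp add: gvec_def S_def x_def p_def threshold_def)
  have "S \<le> 0"
    unfolding S_def
  proof (rule sum_nonpos)
    fix j assume "j \<in> {k..K}"
    with mono[of j] th[of j] show "(x (j - 1) - x j) * threshold Dm \<pi> j \<le> 0"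
      by (simp add: mult_nonpos_nonneg)
  qed
  moreover have "x (k - 1) - x K \<le> S"
  proof -
    have "x (k - 1) - x K = (\<Sum>j=k..K. x (j - 1) - x j)"
    proof -
      have "k - 1 \<le> K" "Suc (k - 1) = k" using k by auto
      with sum_telescope''[of "k - 1" K x] show ?thesis
        by (simp add: sum_subtractf algebra_simps)
    qed
    also have "\<dots> \<le> S"
      unfolding S_def
    proof (rule sum_mono)
      fix j assume "j \<in> {k..K}"
      with mono[of j] th[of j] mult_left_mono_neg[of "threshold Dm \<pi> j" 1 "x (j - 1) - x j"]
      show "x (j - 1) - x j \<le> (x (j - 1) - x j) * threshold Dm \<pi> j" by simp
    qed
    finally show ?thesis .
  qed
  moreover have "x (k - 1) \<in> {0..1}" "x K \<in> {0..1}" "p (k - 1) \<in> {0..1}"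
    using x p k by auto
  ultimately show ?thesis unfolding g by auto
qed

section \<open>Myerson's benchmark\<close>

lemma AE_values_in_unit_cube:
  fixes n :: nat
  assumes "\<And>i. value_dist (D i)"
  shows "AE v in PiM {..<n} D. v \<in> PiE {..<n} (\<lambda>_. {0..1::real})"
proof -
  have ps: "prob_space (D i)" for i
    using assms by (simp add: value_dist_def)
  have "AE v in PiM {..<n} D. \<forall>i\<in>{..<n}. v i \<in> {0..1}"
    by (intro AE_finite_allI AE_PiM_component ps value_dist_AE_unit assms) auto
  then show ?thesis
    using AE_space by eventually_elim (auto simp: space_PiM PiE_def)
qed

text \<open>Shows that the set defining \<open>Mye\<close> is bounded above, so that its supremum is
  meaningful.\<close>

lemma Rev_le:
  assumes D: "\<And>i. value_dist (D i)" and p: "cont_auction n x p"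
  shows "Rev n D p \<le> real n"
proof -
  interpret prob_space "PiM {..<n} D"
    by (rule prob_space_PiM) (use D in \<open>simp add: value_dist_def\<close>)
  have "AE v in PiM {..<n} D. (\<Sum>i<n. p v i) \<le> real n"
    using AE_values_in_unit_cube[OF D]
  proof eventually_elim
    case (elim v)
    have "(\<Sum>i<n. p v i) \<le> (\<Sum>i<n. 1)"
      by (rule sum_mono) (use p elim in \<open>auto simp: cont_auction_def\<close>)
    then show ?case by simp
  qed
  then show ?thesis
    unfolding Rev_def by (intro integral_le_nonneg_const) auto
qed

lemma Rev_le_Mye:
  assumes "\<And>i. value_dist (D i)" and "cont_auction n x p" and "IC n x p" and "IR n x p"
  shows "Rev n D p \<le> Mye n D"
  unfolding Mye_def
  by (rule cSup_upper) (use assms Rev_le in \<open>auto intro!: bdd_aboveI[of _ "real n"]\<close>)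

text \<open>The auction that never sells and never charges is a competitor with revenue 0. The sign
  is what \<open>integral_le_nonneg_const\<close> asks of its bound.\<close>

lemma Mye_nonneg:
  assumes "\<And>i. value_dist (D i)"
  shows "0 \<le> Mye n D"
proof -
  have "Rev n D (\<lambda>_ _. 0) \<le> Mye n D"
    by (rule Rev_le_Mye[where x = "\<lambda>_ _. 0"])
      (use assms in \<open>auto simp: cont_auction_def IC_def IR_def\<close>)
  then show ?thesis by (simp add: Rev_def)
qed

section \<open>A single round\<close>

lemma finite_bid_profiles: "finite (PiE {..<n :: nat} (\<lambda>_. bidset K))"
  by (intro finite_PiE finite_bidset) auto

text \<open>The profiles form a finite set, so it suffices to treat preimages of single profiles,
  which are finite intersections of coordinate events. With a discrete codomain, every function of
  the bids is then measurable, whatever the format.\<close>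

lemma measurable_bid_profile:
  fixes n :: nat
  assumes X: "\<And>i. i < n \<Longrightarrow> X i \<in> borel_measurable N"
    and s: "\<And>i. i < n \<Longrightarrow> s i \<in> borel_measurable borel" "\<And>i v. i < n \<Longrightarrow> s i v \<in> bidset K"
  shows "(\<lambda>w. \<lambda>i\<in>{..<n}. s i (X i w)) \<in> measurable N (count_space (PiE {..<n} (\<lambda>_. bidset K)))"
  unfolding measurable_count_space_eq2[OF finite_bid_profiles]
proof (intro conjI ballI)
  show "(\<lambda>w. \<lambda>i\<in>{..<n}. s i (X i w)) \<in> space N \<rightarrow> PiE {..<n} (\<lambda>_. bidset K)"
    using s by auto
  fix b assume b: "b \<in> PiE {..<n} (\<lambda>_. bidset K)"
  have [measurable]: "(\<lambda>w. s i (X i w)) \<in> borel_measurable N" if "i < n" for i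
    using X s that by (auto intro: measurable_compose)
  have "(\<lambda>w. \<lambda>i\<in>{..<n}. s i (X i w)) -` {b} \<inter> space N
      = {w \<in> space N. \<forall>i\<in>{..<n}. s i (X i w) = b i}"
    using b by (auto simp: PiE_def extensional_def restrict_def fun_eq_iff)
  also have "\<dots> \<in> sets N"
  proof (rule sets.sets_Collect_finite_All)
    show "{w \<in> space N. s i (X i w) = b i} \<in> sets N" if "i \<in> {..<n}" for i
      using that by simp
  qed auto
  finally show "(\<lambda>w. \<lambda>i\<in>{..<n}. s i (X i w)) -` {b} \<inter> space N \<in> sets N" .
qed

lemma integrable_finite_valued:
  fixes \<phi> :: "'a \<Rightarrow> real"
  assumes "prob_space N" and B: "B \<in> measurable N (count_space H)" and H: "finite H"
  shows "integrable N (\<lambda>w. \<phi> (B w))"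
proof -
  interpret prob_space N by fact
  show ?thesis
  proof (rule integrable_const_bound)
    show "AE w in N. norm (\<phi> (B w)) \<le> Max ((\<lambda>b. norm (\<phi> b)) ` H)"
      using measurable_space[OF B] H by (intro AE_I2 Max_ge) auto
    show "(\<lambda>w. \<phi> (B w)) \<in> borel_measurable N"
      by (rule measurable_compose[OF B]) simp
  qed
qed

text \<open>The bid vector built inside \<open>run\<close>, with the same default outside
  \<open>{..<n}\<close>, so that it lies in the extensional product.\<close>

definition bid_profile :: "nat \<Rightarrow> nat \<Rightarrow> (nat \<Rightarrow> real measure) \<Rightarrow> (nat \<Rightarrow> nat \<Rightarrow> real) \<Rightarrow> bids \<Rightarrow> bids" where
  "bid_profile n K D \<pi> v = (\<lambda>i. if i < n then qstrat (D i) K (\<pi> i) (v i) else undefined)"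

text \<open>The past is frozen: the format and the strategies are constants, and only the values of
  the current round are random.\<close>

locale bidding_round =
  fixes n K :: nat and D :: "nat \<Rightarrow> real measure" and M :: fmt and \<pi> :: "nat \<Rightarrow> nat \<Rightarrow> real"
  assumes K_pos: "K > 0"
    and value_dist: "\<And>i. value_dist (D i)"
    and simplex: "\<And>i. i < n \<Longrightarrow> prob_simplex K (\<pi> i)"
    and valid: "valid_format n K M"
begin

abbreviation "\<theta> i \<equiv> threshold (D i) (\<pi> i)"

abbreviation "bids_of \<equiv> bid_profile n K D \<pi>"

text \<open>Agrees almost surely with \<open>bids_of\<close>, but stays monotone above the last
  threshold, where \<open>qstrat\<close> falls back to 0. Incentive compatibility must hold at every
  value, so the auction is built on these bids.\<close>

definition level_bids :: "bids \<Rightarrow> bids" where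
  "level_bids v = (\<lambda>i\<in>{..<n}. real (level K (\<theta> i) (v i)) / real K)"

text \<open>Myerson's payment, value times allocation minus the integral of the allocation up to the
  value, evaluated for a step function with jumps at the thresholds.\<close>

definition myerson_pay :: rule where
  "myerson_pay v i = (\<Sum>j=1..K. of_bool (\<theta> i j < v i) *
     ((fst M ((level_bids v)(i := real j / real K)) i
       - fst M ((level_bids v)(i := real (j - 1) / real K)) i) * \<theta> i j))"

text \<open>Revenue of the round with the regret of each bidder against action 1 removed. These
  regrets are controlled only in total over all rounds, hence they are split off before a single
  round is estimated.\<close>

definition surplus :: "bids \<Rightarrow> real" where
  "surplus b = (\<Sum>i<n. snd M b i
     - (gvec i (D i) K M b (\<pi> i) 1 - (\<Sum>k=1..K+1. \<pi> i k * gvec i (D i) K M b (\<pi> i) k)))"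

lemma level_bids_in_PiE: "level_bids v \<in> PiE {..<n} (\<lambda>_. bidset K)"
  by (auto simp: level_bids_def level_bid_in_bidset)

lemma bids_of_in_PiE: "bids_of v \<in> PiE {..<n} (\<lambda>_. bidset K)"
  by (rule PiE_I) (simp_all add: bid_profile_def qstrat_in_bidset value_dist simplex)

lemma level_bids_upd:
  assumes "i < n"
  shows "level_bids (v(i := w)) = (level_bids v)(i := real (level K (\<theta> i) w) / real K)"
  using assms by (auto simp: level_bids_def fun_eq_iff)

lemma level_bids_self:
  assumes "i < n"
  shows "(level_bids v)(i := real (level K (\<theta> i) (v i)) / real K) = level_bids v"
  using assms by (auto simp: level_bids_def fun_eq_iff)

lemma theta_mono: "i < n \<Longrightarrow> 1 \<le> j \<Longrightarrow> j \<le> k \<Longrightarrow> k \<le> K \<Longrightarrow> \<theta> i j \<le> \<theta> i k"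
  using threshold_mono[OF value_dist simplex] by simp

lemma alloc_telescope:
  assumes "i < n"
  shows "fst M (level_bids v) i = fst M ((level_bids v)(i := 0)) i
    + (\<Sum>j=1..K. of_bool (\<theta> i j < v i) * (fst M ((level_bids v)(i := real j / real K)) i
        - fst M ((level_bids v)(i := real (j - 1) / real K)) i))"
  using level_telescope[where f = "\<lambda>j. fst M ((level_bids v)(i := real j / real K)) i"
      and \<theta> = "\<theta> i" and K = K and v = "v i"] theta_mono[OF assms]
  by (simp add: level_bids_self[OF assms])

text \<open>Apply \<open>level_telescope\<close> to the price as a function of the own bid;
  voluntary participation removes the base term.\<close>

lemma pay_telescope:
  assumes "i < n"
  shows "snd M (level_bids v) i - myerson_pay v i
    = (\<Sum>j=1..K. of_bool (\<theta> i j < v i) * pay_excess i (D i) K M (level_bids v) (\<pi> i) j)"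
proof -
  have "snd M (level_bids v) i = (\<Sum>j=1..K. of_bool (\<theta> i j < v i) *
      (snd M ((level_bids v)(i := real j / real K)) i
        - snd M ((level_bids v)(i := real (j - 1) / real K)) i))"
    using level_telescope[where f = "\<lambda>j. snd M ((level_bids v)(i := real j / real K)) i"
        and \<theta> = "\<theta> i" and K = K and v = "v i"] theta_mono[OF assms]
      valid_format_pay_zero[OF valid level_bids_in_PiE assms]
    by (simp add: level_bids_self[OF assms])
  then show ?thesis
    by (simp add: myerson_pay_def pay_excess_def right_diff_distrib sum_subtractf)
qed

lemma alloc_increment_nonneg:
  assumes "i < n" and "j \<in> {1..K}"
  shows "0 \<le> fst M ((level_bids v)(i := real j / real K)) i
        - fst M ((level_bids v)(i := real (j - 1) / real K)) i"
  using valid_format_mono[OF valid level_bids_in_PiE assms(1), of "j - 1" j] assms by simp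

text \<open>Reporting \<open>w\<close> with true value \<open>v i\<close> buys exactly the allocation increments whose
  thresholds lie below \<open>w\<close>, each at its threshold price.\<close>

lemma myerson_utility:
  assumes "i < n"
  shows "fst M (level_bids (v(i := w))) i * u - myerson_pay (v(i := w)) i
    = fst M ((level_bids v)(i := 0)) i * u
      + (\<Sum>j=1..K. of_bool (\<theta> i j < w) * ((fst M ((level_bids v)(i := real j / real K)) i
        - fst M ((level_bids v)(i := real (j - 1) / real K)) i) * (u - \<theta> i j)))"
  unfolding alloc_telescope[OF assms] myerson_pay_def
  by (simp add: level_bids_upd[OF assms] algebra_simps sum_distrib_left sum_distrib_right
      flip: sum_subtractf sum.distrib)

text \<open>Compare the utilities term by term: increments are nonnegative, so only summands with
  \<open>\<theta> i j < v i\<close> can be positive, and the truthful report collects exactly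
  these.\<close>

lemma myerson_IC: "IC n (\<lambda>v. fst M (level_bids v)) myerson_pay"
  unfolding IC_def
proof (intro allI impI ballI)
  fix i v and w :: real assume i: "i < n"
  let ?dx = "\<lambda>j. fst M ((level_bids v)(i := real j / real K)) i
        - fst M ((level_bids v)(i := real (j - 1) / real K)) i"
  have "(\<Sum>j=1..K. of_bool (\<theta> i j < w) * (?dx j * (v i - \<theta> i j)))
      \<le> (\<Sum>j=1..K. of_bool (\<theta> i j < v i) * (?dx j * (v i - \<theta> i j)))"
  proof (rule sum_mono)
    fix j assume "j \<in> {1..K}"
    with alloc_increment_nonneg[OF i, of j v]
    show "of_bool (\<theta> i j < w) * (?dx j * (v i - \<theta> i j))
      \<le> of_bool (\<theta> i j < v i) * (?dx j * (v i - \<theta> i j))"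
      by (cases "\<theta> i j < w"; cases "\<theta> i j < v i")
        (simp_all add: mult_nonneg_nonneg mult_nonneg_nonpos)
  qed
  then show "fst M (level_bids (v(i := w))) i * v i - myerson_pay (v(i := w)) i
      \<le> fst M (level_bids v) i * v i - myerson_pay v i"
    using myerson_utility[OF i, of v w "v i"] myerson_utility[OF i, of v "v i" "v i"]
    by (simp only: fun_upd_triv)
qed

lemma myerson_IR: "IR n (\<lambda>v. fst M (level_bids v)) myerson_pay"
  unfolding IR_def
proof (intro allI impI ballI)
  fix i v assume i: "i < n" and v: "v \<in> PiE {..<n} (\<lambda>_. {0..1::real})"
  have "0 \<le> v i" using v i by (auto simp: PiE_def Pi_def)
  moreover have "fst M ((level_bids v)(i := 0)) i \<in> {0..1}"
    using valid_format_alloc[OF valid upd_bid_in_PiE[OF level_bids_in_PiE i, of 0] i] by simp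
  ultimately show "0 \<le> fst M (level_bids v) i * v i - myerson_pay v i"
    using myerson_utility[OF i, of v "v i" "v i"] alloc_increment_nonneg[OF i]
    by (auto intro!: sum_nonneg add_nonneg_nonneg)
qed

lemma myerson_cont_auction: "cont_auction n (\<lambda>v. fst M (level_bids v)) myerson_pay"
  unfolding cont_auction_def
proof (intro ballI conjI allI impI)
  fix v i
  show "(\<Sum>i<n. fst M (level_bids v) i) \<le> 1"
    using valid level_bids_in_PiE[of v] by (auto simp: valid_format_def)
  assume i: "i < n"
  have th: "\<theta> i j \<in> {0..1}" if "j \<in> {1..K}" for j
    using threshold_in_unit[OF value_dist simplex[OF i], of j] that by simp
  show "0 \<le> fst M (level_bids v) i"
    using valid_format_alloc[OF valid level_bids_in_PiE i] by simp
  show "0 \<le> myerson_pay v i"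
    unfolding myerson_pay_def using th alloc_increment_nonneg[OF i] by (intro sum_nonneg) simp
  \<comment> \<open>Thresholds are at most 1, so the payment is at most the sum of the purchased
    increments, hence at most the allocation.\<close>
  have "myerson_pay v i \<le> (\<Sum>j=1..K. of_bool (\<theta> i j < v i) *
      (fst M ((level_bids v)(i := real j / real K)) i
        - fst M ((level_bids v)(i := real (j - 1) / real K)) i))"
    unfolding myerson_pay_def
  proof (intro sum_mono mult_left_mono)
    fix j assume "j \<in> {1..K}"
    with th[of j] alloc_increment_nonneg[OF i, of j v] mult_left_mono[of "\<theta> i j" 1]
    show "(fst M ((level_bids v)(i := real j / real K)) i
        - fst M ((level_bids v)(i := real (j - 1) / real K)) i) * \<theta> i j
      \<le> fst M ((level_bids v)(i := real j / real K)) i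
        - fst M ((level_bids v)(i := real (j - 1) / real K)) i" by fastforce
  qed simp
  also have "\<dots> \<le> fst M (level_bids v) i"
    using alloc_telescope[OF i, of v]
      valid_format_alloc[OF valid upd_bid_in_PiE[OF level_bids_in_PiE i, of 0] i, of v] by simp
  also have "\<dots> \<le> 1"
    using valid_format_alloc[OF valid level_bids_in_PiE i] by simp
  finally show "myerson_pay v i \<le> 1" .
qed

section \<open>Expectations over the values of one round\<close>

sublocale P: product_prob_space D "{..<n}"
  by (intro product_prob_spaceI) (use value_dist in \<open>simp add: value_dist_def\<close>)

lemma component_measurable: "i < n \<Longrightarrow> (\<lambda>v. v i) \<in> borel_measurable (PiM {..<n} D)"
proof -
  assume "i < n"
  then have "(\<lambda>v. v i) \<in> measurable (PiM {..<n} D) (D i)"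
    by (intro measurable_component_singleton) simp
  moreover have "measurable (PiM {..<n} D) (D i) = borel_measurable (PiM {..<n} D)"
    by (rule measurable_cong_sets) (use value_dist[of i] in \<open>auto simp: value_dist_def\<close>)
  ultimately show ?thesis by simp
qed

lemma level_bids_measurable:
  "level_bids \<in> measurable (PiM {..<n} D) (count_space (PiE {..<n} (\<lambda>_. bidset K)))"
  unfolding level_bids_def[abs_def]
  by (rule measurable_bid_profile[where s = "\<lambda>i y. real (level K (\<theta> i) y) / real K"
        and X = "\<lambda>i v. v i"])
    (auto intro: component_measurable level_bid_in_bidset)

lemma bids_of_measurable:
  "bids_of \<in> measurable (PiM {..<n} D) (count_space (PiE {..<n} (\<lambda>_. bidset K)))"
proof -
  have "bids_of = (\<lambda>v. \<lambda>i\<in>{..<n}. qstrat (D i) K (\<pi> i) (v i))"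
    by (auto simp: bid_profile_def fun_eq_iff)
  then show ?thesis
    using measurable_bid_profile[where s = "\<lambda>i. qstrat (D i) K (\<pi> i)" and X = "\<lambda>i v. v i"]
      component_measurable measurable_qstrat[OF value_dist simplex]
      qstrat_in_bidset[OF value_dist simplex] by auto
qed

lemma integrable_above_mult:
  fixes \<phi> :: "bids \<Rightarrow> real"
  assumes "i < n"
  shows "integrable (PiM {..<n} D) (\<lambda>v. of_bool (c < v i) * \<phi> (level_bids v))"
proof (rule Bochner_Integration.integrable_bound)
  show int: "integrable (PiM {..<n} D) (\<lambda>v. \<phi> (level_bids v))"
    by (rule integrable_finite_valued[OF P.prob_space_axioms level_bids_measurable finite_bid_profiles])
  have [measurable]: "(\<lambda>v. v i) \<in> borel_measurable (PiM {..<n} D)"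
    using assms by (rule component_measurable)
  have [measurable]: "(\<lambda>v. \<phi> (level_bids v)) \<in> borel_measurable (PiM {..<n} D)"
    using int by (rule borel_measurable_integrable)
  show "(\<lambda>v. of_bool (c < v i) * \<phi> (level_bids v)) \<in> borel_measurable (PiM {..<n} D)"
    by measurable
qed simp

text \<open>Conditionally on the other bids, \<open>of_bool (\<theta> i j < v i)\<close> has mean \<open>1 - \<Pi>\<^sub>j\<close>, which is the
  weight of \<open>pay_excess\<close> in the regret against the action bidding 0.\<close>

lemma expected_pay_eq:
  assumes i: "i < n"
  defines "f \<equiv> \<lambda>v. snd M (level_bids v) i - myerson_pay v i
     - (gvec i (D i) K M (level_bids v) (\<pi> i) 1
        - (\<Sum>k=1..K+1. \<pi> i k * gvec i (D i) K M (level_bids v) (\<pi> i) k))"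
  shows "integrable (PiM {..<n} D) f" and "(\<integral>v. f v \<partial>PiM {..<n} D) = 0"
proof -
  let ?d = "\<lambda>b. pay_excess i (D i) K M b (\<pi> i)"
  have f_eq: "f = (\<lambda>v. \<Sum>j=1..K. of_bool (\<theta> i j < v i) * ?d (level_bids v) j
      - (1 - cumsum (\<pi> i) j) * ?d (level_bids v) j)"
    unfolding f_def pay_telescope[OF i] gvec_regret_first[OF simplex[OF i]] sum_subtractf ..
  have int: "integrable (PiM {..<n} D) (\<lambda>v. \<phi> (level_bids v))" for \<phi> :: "bids \<Rightarrow> real"
    by (rule integrable_finite_valued[OF P.prob_space_axioms level_bids_measurable finite_bid_profiles])
  show f_int: "integrable (PiM {..<n} D) f"
    unfolding f_eq
    by (intro Bochner_Integration.integrable_sum Bochner_Integration.integrable_diff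
        integrable_above_mult[OF i] int)
  \<comment> \<open>Fubini with the value of bidder \<open>i\<close> innermost: the other values
    being fixed, only the own coordinate of \<open>level_bids\<close> moves, which
    \<open>pay_excess\<close> ignores, so only the indicators vary.\<close>
  have split: "insert i ({..<n} - {i}) = {..<n}" using i by auto
  have "(\<integral>v. f v \<partial>PiM {..<n} D)
      = (\<integral>x. (\<integral>y. f (x(i := y)) \<partial>D i) \<partial>PiM ({..<n} - {i}) D)"
    using P.product_integral_insert[of "{..<n} - {i}" i f, unfolded split] f_int by simp
  also have "\<dots> = 0"
  proof -
    have "(\<integral>y. f (x(i := y)) \<partial>D i) = 0" for x
    proof -
      have "(\<integral>y. f (x(i := y)) \<partial>D i) = (\<Sum>j=1..K. \<integral>y. of_bool (\<theta> i j < y) * ?d (level_bids x) j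
          - (1 - cumsum (\<pi> i) j) * ?d (level_bids x) j \<partial>D i)"
        unfolding f_eq using integral_above_threshold(1)[OF value_dist simplex[OF i]]
        by (subst Bochner_Integration.integral_sum [symmetric])
          (auto simp: level_bids_upd[OF i] pay_excess_upd
            intro!: Bochner_Integration.integrable_diff integrable_mult_left)
      also have "\<dots> = 0"
        using integral_above_threshold[OF value_dist simplex[OF i]]
        by (intro sum.neutral ballI)
          (subst Bochner_Integration.integral_diff, auto simp: P.M.prob_space)
      finally show ?thesis .
    qed
    then show ?thesis by simp
  qed
  finally show "(\<integral>v. f v \<partial>PiM {..<n} D) = 0" .
qed

lemma integrable_surplus: "integrable (PiM {..<n} D) (\<lambda>v. surplus (bids_of v))"
  by (rule integrable_finite_valued[OF P.prob_space_axioms bids_of_measurable finite_bid_profiles])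

text \<open>Pass to \<open>level_bids\<close> almost surely, then add and subtract
  \<open>myerson_pay\<close>. The difference has mean zero by \<open>expected_pay_eq\<close>, and
  what remains is the revenue of an IC and IR auction.\<close>

lemma expected_surplus_le_Mye: "(\<integral>v. surplus (bids_of v) \<partial>PiM {..<n} D) \<le> Mye n D"
proof -
  let ?h = "\<lambda>b i. snd M b i - (gvec i (D i) K M b (\<pi> i) 1
     - (\<Sum>k=1..K+1. \<pi> i k * gvec i (D i) K M b (\<pi> i) k))"
  have int: "integrable (PiM {..<n} D) (\<lambda>v. \<phi> (level_bids v))" for \<phi> :: "bids \<Rightarrow> real"
    by (rule integrable_finite_valued[OF P.prob_space_axioms level_bids_measurable finite_bid_profiles])
  have "AE v in PiM {..<n} D. \<forall>i\<in>{..<n}. qstrat (D i) K (\<pi> i) (v i)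
      = real (level K (\<theta> i) (v i)) / real K"
    by (intro AE_finite_allI AE_PiM_component AE_qstrat_eq_level simplex value_dist P.prob_space) auto
  then have "AE v in PiM {..<n} D. bids_of v = level_bids v"
    by eventually_elim (auto simp: bid_profile_def level_bids_def fun_eq_iff)
  then have "(\<integral>v. surplus (bids_of v) \<partial>PiM {..<n} D) = (\<integral>v. surplus (level_bids v) \<partial>PiM {..<n} D)"
    by (intro integral_cong_AE borel_measurable_integrable integrable_surplus int) auto
  also have "\<dots> = (\<integral>v. (\<Sum>i<n. ?h (level_bids v) i - myerson_pay v i) + (\<Sum>i<n. myerson_pay v i) \<partial>PiM {..<n} D)"
    by (simp add: surplus_def sum_subtractf)
  also have "\<dots> = (\<integral>v. (\<Sum>i<n. ?h (level_bids v) i - myerson_pay v i) \<partial>PiM {..<n} D) + Rev n D myerson_pay"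
    unfolding Rev_def
  proof (rule Bochner_Integration.integral_add)
    show "integrable (PiM {..<n} D) (\<lambda>v. \<Sum>i<n. ?h (level_bids v) i - myerson_pay v i)"
      using expected_pay_eq(1) by (intro Bochner_Integration.integrable_sum) (simp add: algebra_simps)
    show "integrable (PiM {..<n} D) (\<lambda>v. \<Sum>i<n. myerson_pay v i)"
      unfolding myerson_pay_def
      by (intro Bochner_Integration.integrable_sum)
        (rule integrable_above_mult[where \<phi> = "\<lambda>b. (fst M (b(_ := _)) _ - fst M (b(_ := _)) _) * _"], simp)
  qed
  also have "(\<integral>v. (\<Sum>i<n. ?h (level_bids v) i - myerson_pay v i) \<partial>PiM {..<n} D) = 0"
    using expected_pay_eq
    by (subst Bochner_Integration.integral_sum) (simp_all add: algebra_simps)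
  also have "0 + Rev n D myerson_pay \<le> Mye n D"
    using Rev_le_Mye[OF value_dist myerson_cont_auction myerson_IC myerson_IR] by simp
  finally show ?thesis .
qed

end

section \<open>The repeated game\<close>

lemma rewards_of_snoc:
  "rewards_of Ai i Dm K (h @ [x])
    = rewards_of Ai i Dm K h @ [gvec i Dm K (fst x) (snd x) (Ai (rewards_of Ai i Dm K h))]"
  by (simp add: rewards_of_def)

lemma length_run [simp]: "length (run n K D A Auc V t) = t"
  by (induction t) (simp_all add: Let_def)

text \<open>The all-zero reward sequence has regret 0.\<close>

lemma regret_bounded_nonneg:
  assumes "regret_bounded K T Ai R"
  shows "0 \<le> R"
proof -
  have *: "regret K T (\<lambda>t. Ai (map (\<lambda>_ _. 0) [0..<t])) (\<lambda>_ _. 0) \<le> R"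
    using assms unfolding regret_bounded_def by auto
  have "regret K T (\<lambda>t. Ai (map (\<lambda>_ _. 0) [0..<t])) (\<lambda>_ _. 0) = Max ((\<lambda>_. 0) ` {1..K+1})"
    unfolding regret_def by (simp del: image_constant_conv)
  then show ?thesis using * by (simp add: image_constant_conv)
qed

text \<open>The seed of the auctioneer is fixed. The distributions are proper for every index,
  phantom bidders included; the theorem arranges this through
  \<open>run_replace_inactive\<close>.\<close>

locale repeated_game =
  fixes n K T :: nat and D :: "nat \<Rightarrow> real measure" and A :: "nat \<Rightarrow> learner"
    and R :: "nat \<Rightarrow> real" and Auc :: auctioneer
  assumes K_pos: "K > 0"
    and value_dist: "\<And>i. value_dist (D i)"
    and learner: "\<And>i. i < n \<Longrightarrow> regret_bounded K T (A i) (R i)"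
    and valid: "\<And>t h \<pi>. valid_format n K (Auc t h \<pi>)"
begin

abbreviation "hist \<equiv> run n K D A Auc"

definition strats :: "(fmt \<times> bids) list \<Rightarrow> nat \<Rightarrow> nat \<Rightarrow> real" where
  "strats h i = A i (rewards_of (A i) i (D i) K h)"

abbreviation "format V t \<equiv> Auc t (hist V t) (strats (hist V t))"

abbreviation "bids V t \<equiv> bid_profile n K D (strats (hist V t)) (\<lambda>i. V (t, i))"

definition reward :: "nat \<Rightarrow> (nat \<times> nat \<Rightarrow> real) \<Rightarrow> nat \<Rightarrow> nat \<Rightarrow> real" where
  "reward i V t = gvec i (D i) K (format V t) (bids V t) (strats (hist V t) i)"

definition admissible :: "(fmt \<times> bids) list \<Rightarrow> bool" where
  "admissible h \<longleftrightarrow> (\<forall>x\<in>set h. valid_format n K (fst x) \<and> snd x \<in> PiE {..<n} (\<lambda>_. bidset K))"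

lemma admissible_snoc:
  "admissible (h @ [x]) \<longleftrightarrow>
    admissible h \<and> valid_format n K (fst x) \<and> snd x \<in> PiE {..<n} (\<lambda>_. bidset K)"
  by (auto simp: admissible_def)

text \<open>The two claims feed each other: bounded past rewards force the learner into the simplex,
  and a simplex strategy makes the next reward bounded by \<open>abs_gvec_le_1\<close>.\<close>

lemma simplex_strats_rewards:
  assumes i: "i < n" and "admissible h"
  shows "prob_simplex K (strats h i)
    \<and> (\<forall>r\<in>set (rewards_of (A i) i (D i) K h). \<forall>k\<in>{1..K+1}. \<bar>r k\<bar> \<le> 1)"
  using assms(2)
proof (induction h rule: rev_induct)
  case Nil
  then show ?case
    using learner[OF i] by (auto simp: strats_def regret_bounded_def rewards_of_def)
next
  case (snoc x h)
  then have IH: "prob_simplex K (strats h i)"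
    "\<forall>r\<in>set (rewards_of (A i) i (D i) K h). \<forall>k\<in>{1..K+1}. \<bar>r k\<bar> \<le> 1"
    and x: "valid_format n K (fst x)" "snd x \<in> PiE {..<n} (\<lambda>_. bidset K)"
    by (auto simp: admissible_def)
  have "\<forall>k\<in>{1..K+1}. \<bar>gvec i (D i) K (fst x) (snd x) (strats h i) k\<bar> \<le> 1"
    using abs_gvec_le_1[OF value_dist IH(1) K_pos x i] by blast
  with IH(2) have "\<forall>r\<in>set (rewards_of (A i) i (D i) K (h @ [x])). \<forall>k\<in>{1..K+1}. \<bar>r k\<bar> \<le> 1"
    by (simp add: rewards_of_snoc strats_def del: atLeastAtMost_iff)
  with learner[OF i] show ?case
    unfolding strats_def regret_bounded_def by blast
qed

lemma bidding_round_strats: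
  "admissible h \<Longrightarrow> bidding_round n K D (Auc t h (strats h)) (strats h)"
  by unfold_locales (use K_pos value_dist valid simplex_strats_rewards in auto)

lemma hist_Suc: "hist V (Suc t) = hist V t @ [(format V t, bids V t)]"
  by (simp add: Let_def strats_def[abs_def] bid_profile_def)

lemma admissible_hist: "admissible (hist V t)"
proof (induction t)
  case (Suc t)
  then show ?case
    using bidding_round.bids_of_in_PiE[OF bidding_round_strats[OF Suc]] valid
    by (auto simp: hist_Suc admissible_def simp del: run.simps)
qed (simp add: admissible_def)

lemma take_hist: "t \<le> m \<Longrightarrow> take t (hist V m) = hist V t"
  by (induction m) (auto simp: hist_Suc le_Suc_eq simp del: run.simps(2))

lemma nth_hist: "t < m \<Longrightarrow> hist V m ! t = (format V t, bids V t)"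
  by (induction m) (auto simp: hist_Suc nth_append less_Suc_eq simp del: run.simps(2))

text \<open>Brings the learner's input into the form \<open>map r [0..<t]\<close> in which
  \<open>regret_bounded\<close> is stated.\<close>

lemma rewards_of_hist: "rewards_of (A i) i (D i) K (hist V t) = map (reward i V) [0..<t]"
proof (induction t)
  case (Suc t)
  then show ?case
    by (simp add: hist_Suc rewards_of_snoc reward_def strats_def del: run.simps)
qed (simp add: rewards_of_def)

text \<open>Causality, which allows round \<open>t\<close> to be integrated with its history held
  fixed.\<close>

lemma hist_cong:
  assumes "\<And>s i. s < t \<Longrightarrow> i < n \<Longrightarrow> V (s, i) = V' (s, i)"
  shows "hist V t = hist V' t"
  using assms by (induction t) (simp_all add: Let_def cong: if_cong)

text \<open>Holds for every realization \<open>V\<close>: the guarantee covers all bounded reward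
  sequences, so also the one generated adaptively along \<open>V\<close>. The maximum in
  \<open>regret\<close> is at least its entry for action 1.\<close>

lemma regret_hist:
  assumes i: "i < n"
  shows "(\<Sum>t<T. reward i V t 1 - (\<Sum>k=1..K+1. strats (hist V t) i k * reward i V t k)) \<le> R i"
proof -
  let ?\<pi> = "\<lambda>t. A i (map (reward i V) [0..<t])"
  have \<pi>: "?\<pi> t = strats (hist V t) i" for t
    by (simp add: strats_def rewards_of_hist)
  have "\<bar>reward i V t k\<bar> \<le> 1" if "k \<in> {1..K+1}" for t k
  proof -
    have "reward i V t \<in> set (rewards_of (A i) i (D i) K (hist V (Suc t)))"
      unfolding rewards_of_hist by simp
    then show ?thesis
      using simplex_strats_rewards[OF i admissible_hist[of V "Suc t"]] that by blast
  qed
  then have "regret K T ?\<pi> (reward i V) \<le> R i"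
    using learner[OF i] unfolding regret_bounded_def by blast
  moreover have "(\<Sum>t<T. reward i V t 1 - (\<Sum>k=1..K+1. ?\<pi> t k * reward i V t k))
      \<le> regret K T ?\<pi> (reward i V)"
    unfolding regret_def by (intro Max_ge) (auto intro!: image_eqI[of _ _ 1])
  ultimately show ?thesis by (simp add: \<pi>)
qed

definition surplus_in :: "(nat \<times> nat \<Rightarrow> real) \<Rightarrow> nat \<Rightarrow> real" where
  "surplus_in V t = bidding_round.surplus n K D (format V t) (strats (hist V t)) (bids V t)"

lemma revenue_le_surplus: "revenue n K T D A Auc V \<le> (\<Sum>t<T. surplus_in V t) + (\<Sum>i<n. R i)"
proof -
  define gap where "gap i t = reward i V t 1 - (\<Sum>k=1..K+1. strats (hist V t) i k * reward i V t k)" for i t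
  define pay where "pay i t = snd (format V t) (bids V t) i" for i t
  have surplus: "surplus_in V t = (\<Sum>i<n. pay i t - gap i t)" for t
    unfolding surplus_in_def gap_def pay_def reward_def
    by (rule bidding_round.surplus_def[OF bidding_round_strats[OF admissible_hist]])
  have "revenue n K T D A Auc V = (\<Sum>t<T. \<Sum>i<n. pay i t)"
    unfolding revenue_def Let_def pay_def by (intro sum.cong refl) (simp add: nth_hist)
  also have "\<dots> = (\<Sum>t<T. surplus_in V t) + (\<Sum>t<T. \<Sum>i<n. gap i t)"
    by (simp add: surplus sum_subtractf)
  also have "(\<Sum>t<T. \<Sum>i<n. gap i t) = (\<Sum>i<n. \<Sum>t<T. gap i t)"
    by (rule sum.swap)
  also have "\<dots> \<le> (\<Sum>i<n. R i)"
    unfolding gap_def by (intro sum_mono regret_hist) simp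
  finally show ?thesis by simp
qed

section \<open>Expectations over all rounds\<close>

sublocale Q: product_prob_space "\<lambda>ti :: nat \<times> nat. D (snd ti)" "{..<T} \<times> {..<n}"
  by (intro product_prob_spaceI) (use value_dist in \<open>simp add: value_dist_def\<close>)

lemma value_measurable:
  assumes "t < T" and "i < n"
  shows "(\<lambda>V. V (t, i)) \<in> borel_measurable (values_measure n T D)"
proof -
  have "(\<lambda>V. V (t, i)) \<in> measurable (values_measure n T D) (D (snd (t, i)))"
    unfolding values_measure_def by (rule measurable_component_singleton) (use assms in simp)
  moreover have "measurable (values_measure n T D) (D (snd (t, i)))
      = borel_measurable (values_measure n T D)"
    by (rule measurable_cong_sets) (use value_dist[of i] in \<open>auto simp: value_dist_def\<close>)
  ultimately show ?thesis by simp
qed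

text \<open>The format is a function of the history, so each history has at most one successor per
  bid profile and only finitely many histories occur. Measurability thus follows for an arbitrary
  auctioneer.\<close>

lemma hist_measurable:
  assumes "t \<le> T"
  shows "\<exists>H. finite H \<and> (\<forall>h\<in>H. admissible h)
    \<and> (\<lambda>V. hist V t) \<in> measurable (values_measure n T D) (count_space H)"
  using assms
proof (induction t)
  case 0
  then show ?case by (intro exI[of _ "{[]}"]) (simp add: admissible_def)
next
  case (Suc t)
  then obtain H where H: "finite H" "\<And>h. h \<in> H \<Longrightarrow> admissible h"
    and meas: "(\<lambda>V. hist V t) \<in> measurable (values_measure n T D) (count_space H)" by auto
  let ?B = "PiE {..<n} (\<lambda>_. bidset K)"
  let ?next = "\<lambda>h b. h @ [(Auc t h (strats h), b)]"
  define H' where "H' = (\<lambda>(h, b). ?next h b) ` (H \<times> ?B)"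
  have "(\<lambda>V. hist V (Suc t)) \<in> measurable (values_measure n T D) (count_space H')"
    unfolding hist_Suc
  \<comment> \<open>The past takes countably many values, so it may be fixed to one
    \<open>h\<close>; the strategies and the format of the round then become constants.\<close>
  proof (rule measurable_compose_countable'[OF _ meas])
    fix h assume h: "h \<in> H"
    interpret bidding_round n K D "Auc t h (strats h)" "strats h"
      by (rule bidding_round_strats[OF H(2)[OF h]])
    have "(\<lambda>V. \<lambda>i\<in>{..<n}. qstrat (D i) K (strats h i) (V (t, i)))
        \<in> measurable (values_measure n T D) (count_space ?B)"
      using Suc.prems
      by (intro measurable_bid_profile value_measurable measurable_qstrat qstrat_in_bidset
          value_dist simplex) auto
    moreover have "(\<lambda>i\<in>{..<n}. qstrat (D i) K (strats h i) (V (t, i))) = bids_of (\<lambda>i. V (t, i))" for V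
      by (auto simp: bid_profile_def fun_eq_iff)
    ultimately have "(\<lambda>V. bids_of (\<lambda>i. V (t, i))) \<in> measurable (values_measure n T D) (count_space ?B)"
      by simp
    then show "(\<lambda>V. ?next h (bids_of (\<lambda>i. V (t, i)))) \<in> measurable (values_measure n T D) (count_space H')"
      by (rule measurable_compose) (use h in \<open>auto simp: H'_def\<close>)
  qed (use H in \<open>simp add: countable_finite\<close>)
  moreover have "finite H'"
    unfolding H'_def using H finite_bid_profiles by auto
  moreover have "\<forall>h\<in>H'. admissible h"
    using H(2) valid by (clarsimp simp: H'_def admissible_snoc)
  ultimately show ?case by blast
qed

lemma prob_space_values: "prob_space (values_measure n T D)"
  unfolding values_measure_def by (rule Q.prob_space_axioms)

lemma integrable_hist:
  fixes \<phi> :: "(fmt \<times> bids) list \<Rightarrow> real"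
  assumes "t \<le> T"
  shows "integrable (values_measure n T D) (\<lambda>V. \<phi> (hist V t))"
  using hist_measurable[OF assms] integrable_finite_valued[OF prob_space_values] by blast

lemma integrable_surplus_in:
  assumes "t < T"
  shows "integrable (values_measure n T D) (\<lambda>V. surplus_in V t)"
proof -
  \<comment> \<open>The history after round \<open>t\<close> determines the surplus: its last entry
    holds format and bids, and \<open>take t\<close> recovers the past that fixes the
    strategies.\<close>
  have "surplus_in V t = (\<lambda>h. bidding_round.surplus n K D (fst (h ! t)) (strats (take t h)) (snd (h ! t)))
      (hist V (Suc t))" for V
    unfolding surplus_in_def by (simp add: nth_hist take_hist del: run.simps)
  then show ?thesis
    using integrable_hist[of "Suc t"] assms by simp
qed

text \<open>Split the values into those before round \<open>t\<close> and the rest, and integrate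
  the rest first. Given the past, strategies and format are constants and the values of round
  \<open>t\<close> are fresh, so the bound for a single round applies to every past.\<close>

lemma expected_surplus_in_le_Mye:
  assumes t: "t < T"
  shows "(\<integral>V. surplus_in V t \<partial>values_measure n T D) \<le> Mye n D"
proof -
  let ?D = "\<lambda>ti :: nat \<times> nat. D (snd ti)"
  let ?I = "{..<t} \<times> {..<n}" and ?J = "{t..<T} \<times> {..<n}"
  have IJ: "?I \<union> ?J = {..<T} \<times> {..<n}" using t by auto
  have ps: "prob_space (PiM X ?D)" for X
    by (rule prob_space_PiM) (use value_dist in \<open>simp add: value_dist_def\<close>)
  have "integrable (PiM (?I \<union> ?J) ?D) (\<lambda>V. surplus_in V t)"
    using integrable_surplus_in[OF t] unfolding IJ values_measure_def .
  then have "(\<integral>V. surplus_in V t \<partial>PiM (?I \<union> ?J) ?D)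
      = (\<integral>x. (\<integral>y. surplus_in (merge ?I ?J (x, y)) t \<partial>PiM ?J ?D) \<partial>PiM ?I ?D)"
    by (intro Q.product_integral_fold) auto
  then have "(\<integral>V. surplus_in V t \<partial>values_measure n T D)
      = (\<integral>x. (\<integral>y. surplus_in (merge ?I ?J (x, y)) t \<partial>PiM ?J ?D) \<partial>PiM ?I ?D)"
    unfolding IJ values_measure_def .
  also have "\<dots> \<le> Mye n D"
  proof (rule prob_space.integral_le_nonneg_const[OF ps Mye_nonneg[OF value_dist] AE_I2])
    fix x
    let ?h = "hist x t"
    interpret bidding_round n K D "Auc t ?h (strats ?h)" "strats ?h"
      by (rule bidding_round_strats[OF admissible_hist])
    let ?f = "\<lambda>v. surplus (bids_of v)"
    let ?row = "\<lambda>y. \<lambda>i\<in>{..<n}. y (t, i)"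
    have row: "surplus_in (merge ?I ?J (x, y)) t = ?f (?row y)" for y
    proof -
      have "hist (merge ?I ?J (x, y)) t = ?h"
        by (rule hist_cong) (auto simp: merge_def)
      moreover have "bids_of (\<lambda>i. merge ?I ?J (x, y) (t, i)) = bids_of (?row y)"
        using t by (auto simp: bid_profile_def fun_eq_iff merge_def)
      ultimately show ?thesis by (simp add: surplus_in_def)
    qed
    \<comment> \<open>Projecting to round \<open>t\<close> discards the later rounds and leaves the
      product law of its values.\<close>
    have "distr (PiM ?J ?D) (PiM {..<n} (\<lambda>i. ?D (t, i))) ?row = PiM {..<n} (\<lambda>i. ?D (t, i))"
      by (rule distr_PiM_reindex) (use t value_dist in \<open>auto simp: value_dist_def inj_on_def\<close>)
    then have distr: "distr (PiM ?J ?D) (PiM {..<n} D) ?row = PiM {..<n} D" by simp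
    have "(\<integral>y. ?f (?row y) \<partial>PiM ?J ?D) = (\<integral>v. ?f v \<partial>distr (PiM ?J ?D) (PiM {..<n} D) ?row)"
    proof (rule integral_distr[symmetric])
      show "?row \<in> measurable (PiM ?J ?D) (PiM {..<n} D)"
      proof (rule measurable_restrict)
        fix i assume "i \<in> {..<n}"
        then show "(\<lambda>y. y (t, i)) \<in> measurable (PiM ?J ?D) (D i)"
          using measurable_component_singleton[of "(t, i)" ?J ?D] t by simp
      qed
    qed (rule borel_measurable_integrable[OF integrable_surplus])
    then show "(\<integral>y. surplus_in (merge ?I ?J (x, y)) t \<partial>PiM ?J ?D) \<le> Mye n D"
      using expected_surplus_le_Mye by (simp add: row distr)
  qed
  finally show ?thesis .
qed

lemma expected_revenue_le:
  "(\<integral>V. revenue n K T D A Auc V \<partial>values_measure n T D) \<le> Mye n D * real T + (\<Sum>i<n. R i)"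
proof -
  interpret V: prob_space "values_measure n T D" by (rule prob_space_values)
  have int: "integrable (values_measure n T D) (\<lambda>V. \<Sum>t<T. surplus_in V t)"
    by (intro Bochner_Integration.integrable_sum integrable_surplus_in) simp
  have "(\<integral>V. revenue n K T D A Auc V \<partial>values_measure n T D)
      \<le> (\<integral>V. (\<Sum>t<T. surplus_in V t) + (\<Sum>i<n. R i) \<partial>values_measure n T D)"
  proof (rule integral_mono)
    show "integrable (values_measure n T D) (revenue n K T D A Auc)"
      using integrable_hist[of T "\<lambda>h. \<Sum>t<T. \<Sum>i<n. snd (fst (h ! t)) (snd (h ! t)) i"]
      by (simp add: revenue_def[abs_def] Let_def)
  qed (use int revenue_le_surplus in auto)
  also have "\<dots> = (\<Sum>t<T. \<integral>V. surplus_in V t \<partial>values_measure n T D) + (\<Sum>i<n. R i)"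
    using int integrable_surplus_in by (simp add: V.prob_space)
  also have "(\<Sum>t<T. \<integral>V. surplus_in V t \<partial>values_measure n T D) \<le> (\<Sum>t<T. Mye n D)"
    by (intro sum_mono expected_surplus_in_le_Mye) simp
  finally show ?thesis by (simp add: mult.commute)
qed

end

text \<open>Nothing is assumed about \<open>D i\<close> for \<open>i \<ge> n\<close>, yet the auctioneer sees
  strategies indexed by all of \<open>nat\<close>. Changing these \<open>D i\<close> is compensated by an auctioneer who
  recomputes the strategies of the phantom bidders.\<close>

lemma run_replace_inactive:
  assumes "\<And>i. i < n \<Longrightarrow> D' i = D i"
  shows "run n K D A Auc V t
    = run n K D' A (\<lambda>t h \<pi>. Auc t h (\<lambda>i. if i < n then \<pi> i else A i (rewards_of (A i) i (D i) K h))) V t"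
proof (induction t)
  case (Suc t)
  let ?h = "run n K D A Auc V t"
  have "(\<lambda>i. A i (rewards_of (A i) i (D i) K ?h))
    = (\<lambda>i. if i < n then A i (rewards_of (A i) i (D' i) K ?h) else A i (rewards_of (A i) i (D i) K ?h))"
    using assms by auto
  moreover have "(\<lambda>i. if i < n then qstrat (D i) K (A i (rewards_of (A i) i (D i) K ?h)) (V (t, i)) else undefined)
    = (\<lambda>i. if i < n then qstrat (D' i) K (A i (rewards_of (A i) i (D' i) K ?h)) (V (t, i)) else undefined)"
    using assms by auto
  ultimately show ?case
    by (simp only: run.simps Let_def Suc.IH[symmetric])
qed simp

theorem mainTheorem1:
  fixes n K T :: nat
    and D :: "nat \<Rightarrow> real measure"
    and A :: "nat \<Rightarrow> learner"
    and Reg :: "nat \<Rightarrow> real"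
    and W :: "'w measure"
    and Auc :: "'w \<Rightarrow> auctioneer"
  assumes "n > 0" and "K > 0" and "T > 0"
    and "\<forall>i<n. value_dist (D i)"
    and "\<forall>i<n. regret_bounded K T (A i) (Reg i)"
    and "prob_space W"
    and "\<forall>\<omega>\<in>space W. \<forall>t h \<pi>. valid_format n K (Auc \<omega> t h \<pi>)"
  shows "(\<integral>\<omega>. (\<integral>V. revenue n K T D A (Auc \<omega>) V \<partial>values_measure n T D) \<partial>W)
           \<le> Mye n D * real T + (\<Sum>i<n. Reg i)"
proof -
  \<comment> \<open>Phantom indices receive a copy of \<open>D 0\<close>, a proper distribution
    because there is at least one bidder.\<close>
  define E where "E i = (if i < n then D i else D 0)" for i
  have E: "value_dist (E i)" for i
    using assms(1,4) by (simp add: E_def)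
  have "PiM {..<n} D = PiM {..<n} E"
    by (rule PiM_cong) (auto simp: E_def)
  then have Mye: "Mye n D = Mye n E"
    by (simp add: Mye_def Rev_def)
  have vals: "values_measure n T D = values_measure n T E"
    unfolding values_measure_def by (rule PiM_cong) (auto simp: E_def)
  \<comment> \<open>The bound is proved for each seed separately; its sign lets it pass to the
    integral over seeds even if the revenue is not integrable in the seed.\<close>
  have "0 \<le> Mye n D * real T + (\<Sum>i<n. Reg i)"
    using Mye_nonneg[OF E, of n] regret_bounded_nonneg assms(5)
    by (auto simp: Mye intro!: add_nonneg_nonneg sum_nonneg)
  then show ?thesis
  proof (rule prob_space.integral_le_nonneg_const[OF assms(6) _ AE_I2])
    fix \<omega> assume \<omega>: "\<omega> \<in> space W"
    let ?Auc = "\<lambda>t h \<pi>. Auc \<omega> t h (\<lambda>i. if i < n then \<pi> i else A i (rewards_of (A i) i (D i) K h))"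
    interpret repeated_game n K T E A Reg ?Auc
      by unfold_locales (use assms E \<omega> in auto)
    have "revenue n K T D A (Auc \<omega>) V = revenue n K T E A ?Auc V" for V
      unfolding revenue_def using run_replace_inactive[of n E D K A "Auc \<omega>" V T] by (simp add: E_def)
    then show "(\<integral>V. revenue n K T D A (Auc \<omega>) V \<partial>values_measure n T D)
        \<le> Mye n D * real T + (\<Sum>i<n. Reg i)"
      using expected_revenue_le by (simp add: vals Mye)
  qed
qed

end
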